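(* Let $\mathscr{F}=(X,I)$ be a quasi-$1$-plane. Then: (1) $I^2$ is an equivalence relation on $X$. (2) For all $a,b\in X$, $aIb$ implies $aI^3b$. (3) $\mathscr{F}$ is connected if and only if it satisfies condition O2: for all $a,b\in X$, $aI^2b$ or $aI^3b$. (4) If $\mathscr{F}$ is connected, then for any element $a\in X$, the subsets $I^2(a)=\{x\in X:aI^2x\}$ and $I^3(a)=\{x\in X:aI^3x\}$ are the only $I^2$-equivalence classes. (5) If $\mathscr{F}$ is connected, then for any element $a\in X$ and any $x,y\in X$ with $xIy$, one of $x$ and $y$ is in $I^2(a)$ and the other is in $I^3(a)$.
   Context: A $1$-frame is a pair $\mathscr{F}=(X,I)$ with $I\subseteq X\times X$. $I^n$ denotes the $n$-fold relational composition of $I$ with itself ($I^0$ is the identity), so $aI^nb$ iff there is a sequence $a=a_0Ia_1I\cdots Ia_n=b$. $I$ is serial if every $a\in X$ has some $b$ with $aIb$. A quasi-$1$-plane is a $1$-frame in which $I$ is serial and symmetric and which satisfies O1: for all $a,b$, $aI^4b$ implies $aI^2b$. Let $I_+=I\cup\{(b,a):aIb\}$. $\mathscr{F}$ is connected if for any two elements there is an $I_+$-path from one to the other (a finite sequence $a_0I_+a_1I_+\cdots I_+a_n$). *)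

theory Defs
  imports Main
begin

text \<open>
  A 1-frame is a carrier \<open>X\<close> together with \<open>I \<subseteq> X \<times> X\<close>. The power \<open>I\<^sup>n\<close> is the library's
  \<open>I ^^ n\<close>. The library's \<open>I ^^ 0\<close> is the identity on the whole type rather than on \<open>X\<close>;
  below, only positive exponents are used, where the two readings agree.
\<close>

definition one_frame :: "'a set \<Rightarrow> 'a rel \<Rightarrow> bool" where
  "one_frame X I \<longleftrightarrow> I \<subseteq> X \<times> X"

definition serial_on :: "'a set \<Rightarrow> 'a rel \<Rightarrow> bool" where
  "serial_on X I \<longleftrightarrow> (\<forall>a\<in>X. \<exists>b\<in>X. (a, b) \<in> I)"

definition cond_O1 :: "'a set \<Rightarrow> 'a rel \<Rightarrow> bool" where
  "cond_O1 X I \<longleftrightarrow> (\<forall>a\<in>X. \<forall>b\<in>X. (a, b) \<in> I ^^ 4 \<longrightarrow> (a, b) \<in> I ^^ 2)"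

definition cond_O2 :: "'a set \<Rightarrow> 'a rel \<Rightarrow> bool" where
  "cond_O2 X I \<longleftrightarrow> (\<forall>a\<in>X. \<forall>b\<in>X. (a, b) \<in> I ^^ 2 \<or> (a, b) \<in> I ^^ 3)"

definition quasi_one_plane :: "'a set \<Rightarrow> 'a rel \<Rightarrow> bool" where
  "quasi_one_plane X I \<longleftrightarrow> one_frame X I \<and> serial_on X I \<and> sym I \<and> cond_O1 X I"

definition sym_closure :: "'a rel \<Rightarrow> 'a rel" where
  "sym_closure I = I \<union> {(b, a). (a, b) \<in> I}"

text \<open>
  Membership in the reflexive transitive closure is the existence of a finite path
  \<open>a\<^sub>0, \<dots>, a\<^sub>n\<close> with \<open>n \<ge> 0\<close>.
\<close>

definition connected_frame :: "'a set \<Rightarrow> 'a rel \<Rightarrow> bool" where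
  "connected_frame X I \<longleftrightarrow> (\<forall>a\<in>X. \<forall>b\<in>X. (a, b) \<in> (sym_closure I)\<^sup>*)"

definition power_image :: "'a set \<Rightarrow> 'a rel \<Rightarrow> nat \<Rightarrow> 'a \<Rightarrow> 'a set" where
  "power_image X I n a = {x \<in> X. (a, x) \<in> I ^^ n}"

end

theory Submission
  imports Defs
begin

text \<open>
  By symmetry and seriality a step can be followed by its reverse, so every path can be
  lengthened by two steps; condition O1 gives the converse for paths of length 4. Hence the
  ends of any path are related by \<open>I\<^sup>2\<close> if its length is even and by \<open>I\<^sup>3\<close> if it is odd.
  If \<open>a I b\<close>, then \<open>I\<^sup>3(a)\<close> is the \<open>I\<^sup>2\<close>-class of \<open>b\<close>.
\<close>

context
  fixes X :: "'a set" and I :: "'a rel"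
  assumes plane: "quasi_one_plane X I"
begin

lemma in_carrier:
  assumes "(a, b) \<in> I"
  shows "a \<in> X" "b \<in> X"
  using assms plane by (auto simp: quasi_one_plane_def one_frame_def)

lemma incidence_sym: "(a, b) \<in> I \<Longrightarrow> (b, a) \<in> I"
  using plane by (auto simp: quasi_one_plane_def dest: symD)

lemma exists_incident:
  assumes "a \<in> X"
  obtains b where "(a, b) \<in> I"
  using assms plane by (auto simp: quasi_one_plane_def serial_on_def)

lemma relpow_two_iff: "(a, b) \<in> I ^^ 2 \<longleftrightarrow> (\<exists>c. (a, c) \<in> I \<and> (c, b) \<in> I)"
  by (auto simp: numeral_eq_Suc)

lemma relpow_three_iff: "(a, b) \<in> I ^^ 3 \<longleftrightarrow> (\<exists>c. (a, c) \<in> I ^^ 2 \<and> (c, b) \<in> I)"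
  by (auto simp: numeral_eq_Suc)

lemma relpow_three_iff': "(a, b) \<in> I ^^ 3 \<longleftrightarrow> (\<exists>c. (a, c) \<in> I \<and> (c, b) \<in> I ^^ 2)"
  by (auto simp: numeral_eq_Suc)

lemma relpow_two_in_carrier:
  assumes "(a, b) \<in> I ^^ 2"
  shows "a \<in> X" "b \<in> X"
  using assms in_carrier by (auto simp: relpow_two_iff)

text \<open>Two paths of length 2 concatenate to one of length 4, which O1 shortens. This is the
  only direct use of O1.\<close>

lemma relpow_two_trans:
  assumes "(a, b) \<in> I ^^ 2" "(b, c) \<in> I ^^ 2"
  shows "(a, c) \<in> I ^^ 2"
proof -
  have "(a, c) \<in> I ^^ (2 + 2)"
    using assms unfolding relpow_add by blast
  then have "(a, c) \<in> I ^^ 4"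
    by simp
  moreover have "a \<in> X" "c \<in> X"
    using assms relpow_two_in_carrier by blast+
  ultimately show ?thesis
    using plane by (auto simp: quasi_one_plane_def cond_O1_def)
qed

text \<open>The four steps regroup as two pairs, so transitivity of \<open>I ^^ 2\<close>
  applies.\<close>

lemma relpow_three_step:
  assumes "(a, b) \<in> I ^^ 3" "(b, c) \<in> I"
  shows "(a, c) \<in> I ^^ 2"
  by (meson assms relpow_three_iff relpow_two_iff relpow_two_trans)

lemma relpow_two_equiv: "equiv X (I ^^ 2)"
proof (rule equivI)
  show "I ^^ 2 \<subseteq> X \<times> X"
    using relpow_two_in_carrier by auto
  \<comment> \<open>Seriality gives a neighbour to visit, and symmetry gives the way back.\<close>
  show "refl_on X (I ^^ 2)"
    by (rule refl_onI) (meson exists_incident incidence_sym relpow_two_iff)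
  show "sym (I ^^ 2)"
    by (rule symI) (meson incidence_sym relpow_two_iff)
  show "trans (I ^^ 2)"
    by (rule transI) (rule relpow_two_trans)
qed

lemma relpow_two_refl: "a \<in> X \<Longrightarrow> (a, a) \<in> I ^^ 2"
  using relpow_two_equiv by (blast elim: equivE dest: refl_onD)

lemma incidence_imp_relpow_three: "(a, b) \<in> I \<Longrightarrow> (a, b) \<in> I ^^ 3"
  using relpow_two_refl in_carrier by (auto simp: relpow_three_iff)

lemma sym_closure_eq: "sym_closure I = I"
  using incidence_sym by (auto simp: sym_closure_def)

lemma connected_iff_O2: "connected_frame X I \<longleftrightarrow> cond_O2 X I"
proof
  assume conn: "connected_frame X I"
  \<comment> \<open>Each further step of the path switches between the two disjuncts. The empty path
    falls under \<open>I ^^ 2\<close> by reflexivity, which is why \<open>a\<close> must lie in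
    \<open>X\<close>.\<close>
  have "(a, b) \<in> I ^^ 2 \<or> (a, b) \<in> I ^^ 3" if "a \<in> X" "(a, b) \<in> I\<^sup>*" for a b
    using that(2)
  proof (induction rule: rtrancl_induct)
    case base
    show ?case
      using relpow_two_refl that(1) by blast
  next
    case (step y z)
    then show ?case
      using relpow_three_step relpow_three_iff by blast
  qed
  then show "cond_O2 X I"
    using conn by (auto simp: connected_frame_def cond_O2_def sym_closure_eq)
next
  assume "cond_O2 X I"
  then show "connected_frame X I"
    unfolding connected_frame_def cond_O2_def sym_closure_eq
    by (meson relpow_imp_rtrancl)
qed

lemma power_image_two: "power_image X I 2 a = (I ^^ 2) `` {a}"
  using relpow_two_in_carrier by (auto simp: power_image_def)

text \<open>A path of length 3 from \<open>a\<close> begins with a step to some \<open>c\<close>.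
  Going from \<open>b\<close> back to \<open>a\<close> and on to \<open>c\<close> relates
  \<open>b\<close> to \<open>c\<close> by \<open>I ^^ 2\<close>, so the rest follows by
  transitivity. Conversely, the step from \<open>a\<close> to \<open>b\<close> is put in front of a
  path of length 2.\<close>

lemma power_image_three:
  assumes "(a, b) \<in> I"
  shows "power_image X I 3 a = (I ^^ 2) `` {b}"
proof -
  have "(b, x) \<in> I ^^ 2" if "(a, x) \<in> I ^^ 3" for x
    using that assms incidence_sym relpow_two_trans relpow_two_iff
    unfolding relpow_three_iff' by meson
  then show ?thesis
    using assms relpow_two_in_carrier relpow_three_iff' by (auto simp: power_image_def)
qed

text \<open>A neighbour \<open>b\<close> of \<open>a\<close> represents the second class. The two
  classes may coincide, for instance when \<open>(a, a) \<in> I\<close>.\<close>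

lemma quotient_eq_power_images:
  assumes conn: "connected_frame X I" and a: "a \<in> X"
  shows "X // (I ^^ 2) = {power_image X I 2 a, power_image X I 3 a}"
proof -
  obtain b where ab: "(a, b) \<in> I"
    using a by (rule exists_incident)
  have "(I ^^ 2) `` {x} \<in> {(I ^^ 2) `` {a}, (I ^^ 2) `` {b}}" if x: "x \<in> X" for x
  proof -
    have "x \<in> power_image X I 2 a \<or> x \<in> power_image X I 3 a"
      using conn a x by (auto simp: connected_iff_O2 cond_O2_def power_image_def)
    then have "(a, x) \<in> I ^^ 2 \<or> (b, x) \<in> I ^^ 2"
      by (simp add: power_image_two power_image_three[OF ab])
    then show ?thesis
      using equiv_class_eq[OF relpow_two_equiv] by blast
  qed
  then have "X // (I ^^ 2) = {(I ^^ 2) `` {a}, (I ^^ 2) `` {b}}"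
    using a in_carrier(2)[OF ab] by (auto simp: quotient_def)
  then show ?thesis
    by (simp add: power_image_two power_image_three[OF ab])
qed

text \<open>Whichever of the two sets contains \<open>x\<close>, the step to \<open>y\<close> leads
  into the other one.\<close>

lemma incident_in_opposite_power_images:
  assumes "connected_frame X I" "a \<in> X" "(x, y) \<in> I"
  shows "(x \<in> power_image X I 2 a \<and> y \<in> power_image X I 3 a) \<or>
         (y \<in> power_image X I 2 a \<and> x \<in> power_image X I 3 a)"
proof -
  have "(a, x) \<in> I ^^ 2 \<or> (a, x) \<in> I ^^ 3"
    using assms in_carrier by (auto simp: connected_iff_O2 cond_O2_def)
  then show ?thesis
    using assms(3) in_carrier[OF assms(3)] relpow_three_step relpow_three_iff
    unfolding power_image_def by blast
qed

end

theorem theorem3p2: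
  fixes X :: "'a set" and I :: "'a rel"
  assumes "quasi_one_plane X I"
  shows "equiv X (I ^^ 2)
    \<and> (\<forall>a\<in>X. \<forall>b\<in>X. (a, b) \<in> I \<longrightarrow> (a, b) \<in> I ^^ 3)
    \<and> (connected_frame X I \<longleftrightarrow> cond_O2 X I)
    \<and> (connected_frame X I \<longrightarrow>
        (\<forall>a\<in>X. X // (I ^^ 2) = {power_image X I 2 a, power_image X I 3 a}))
    \<and> (connected_frame X I \<longrightarrow>
        (\<forall>a\<in>X. \<forall>x\<in>X. \<forall>y\<in>X. (x, y) \<in> I \<longrightarrow>
          (x \<in> power_image X I 2 a \<and> y \<in> power_image X I 3 a) \<or>
          (y \<in> power_image X I 2 a \<and> x \<in> power_image X I 3 a)))"
  using relpow_two_equiv[OF assms] incidence_imp_relpow_three[OF assms]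
    connected_iff_O2[OF assms] quotient_eq_power_images[OF assms]
    incident_in_opposite_power_images[OF assms]
  by (intro conjI impI ballI)

end
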